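(* Let $G$ be a rooted graph with labeling $\lambda:V(G)\to Y$, $\lambda(v_x)=x$ for all $x\in Y$, and let $j\in Y$ be the label of the root of $G$. Let $G^\dagger$ be the graph obtained from $G$ by adding a new vertex $v_i$, with new label $i\notin Y$, joined by an edge to the root $v_j$ only (so $v_i$ is the newly added leaf of $G^\dagger$). For a permutation $\sigma\in\operatorname{Sym}(Y)$ let $\sigma\cup\operatorname{id}$ denote the permutation of $Y\cup\{i\}$ that agrees with $\sigma$ on $Y$ and fixes $i$. Then: (i) the map $f:\mathcal{E}_G^j\cup\operatorname{Aut}(G)\to\mathcal{E}_{G^\dagger}^i$ given by $\sigma\mapsto\sigma\cup\operatorname{id}$ is a bijection; (ii) the map $\tilde f:\mathbf{H}_j(G)\to\operatorname{Fer}^i(G^\dagger)$ given by $\sigma\mapsto\sigma\cup\operatorname{id}$ is a group isomorphism; (iii) $G^\dagger$ is stem-symmetric at $v_i$ if and only if $G$ is hang-symmetric at $v_j$.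
   Context: All graphs are finite and simple. A labeled graph $G$ comes with a bijection $\lambda:V(G)\to X$ onto a label set $X$; write $v_x=\lambda^{-1}(x)$ and $L_G=\{ij: v_iv_j\in E(G)\}$ (unordered pairs). For $\sigma\in\operatorname{Sym}(X)$, $G_\sigma$ is the graph on $V(G)$ with edge set $\{v_iv_j:\sigma(i)\sigma(j)\in L_G\}$. $\operatorname{Aut}(G)$ is identified with $\{\sigma\in\operatorname{Sym}(X): G_\sigma=G\}$. An edge-replacement $rs\to kl$ removes an edge $v_rv_s\in E(G)$ and adds $v_kv_l\in E(\overline G)\cup\{v_rv_s\}$; it is feasible if $G-v_rv_s+v_kv_l\cong G$. $R_G$ is the set of feasible edge-replacements $rs\to kl$ with $rs\ne kl$ together with the neutral replacement $\emptyset\to\emptyset$ (nothing changes). $\operatorname{Fer}_G(rs\to kl)=\{\sigma\in\operatorname{Sym}(X): G_\sigma=G-v_rv_s+v_kv_l\}$ and $\operatorname{Fer}_G(\emptyset\to\emptyset)=\operatorname{Aut}(G)$. $\mathcal{E}_G$ is the union of the sets $\operatorname{Fer}_G(e\to e')$ over all $e\to e'\in R_G$, and $\operatorname{Fer}(G)=\langle\mathcal{E}_G\rangle\le\operatorname{Sym}(X)$. For $i\in X$, $\mathcal{E}_G^i=\{\sigma\in\mathcal{E}_G:\sigma(i)=i\}$ and $\operatorname{Fer}^i(G)=\langle\mathcal{E}_G^i\rangle$. $G$ is stem-symmetric at the vertex $v_i$ (or at the label $i$) if $\operatorname{Fer}^i(G)\cong S_{|V(G)|-1}$. The hang group of $G$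 at $i$ is $\mathbf{H}_i(G)=\langle\mathcal{E}_G^i\cup\operatorname{Aut}(G)\rangle$, and $G$ is hang-symmetric at $v_i$ (or at $i$) if $\mathbf{H}_i(G)=\operatorname{Sym}(X)$. *)

theory Defs
  imports "HOL-Algebra.Bij" "HOL-Algebra.Sym_Groups" "HOL-Algebra.Generated_Groups"
begin

text \<open>
  Edges are two-element sets of vertices. The symmetric group on a label set \<open>X\<close> is
  \<^const>\<open>BijGroup\<close> \<open>X\<close>, whose elements are functions that are \<^const>\<open>undefined\<close> outside \<open>X\<close>.
\<close>

record 'v ugraph =
  verts :: "'v set"
  edges :: "'v set set"

record ('v, 'l) lgraph = "'v ugraph" +
  labels :: "'l set"
  lab :: "'v \<Rightarrow> 'l"

definition simple_graph :: "('v, 'm) ugraph_scheme \<Rightarrow> bool" where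
  "simple_graph G \<longleftrightarrow> finite (verts G) \<and> (\<forall>e \<in> edges G. e \<subseteq> verts G \<and> card e = 2)"

definition complement_edges :: "('v, 'm) ugraph_scheme \<Rightarrow> 'v set set" where
  "complement_edges G = {e. e \<subseteq> verts G \<and> card e = 2 \<and> e \<notin> edges G}"

definition graph_isomorphic ::
  "('v, 'm) ugraph_scheme \<Rightarrow> ('w, 'n) ugraph_scheme \<Rightarrow> bool" where
  "graph_isomorphic G H \<longleftrightarrow>
     (\<exists>f. bij_betw f (verts G) (verts H) \<and>
          (\<forall>u \<in> verts G. \<forall>v \<in> verts G. {u, v} \<in> edges G \<longleftrightarrow> {f u, f v} \<in> edges H))"

definition labeled_graph :: "('v, 'l) lgraph \<Rightarrow> bool" where
  "labeled_graph G \<longleftrightarrow> simple_graph G \<and> bij_betw (lab G) (verts G) (labels G)"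

definition vtx :: "('v, 'l) lgraph \<Rightarrow> 'l \<Rightarrow> 'v" where
  "vtx G x = inv_into (verts G) (lab G) x"

definition label_edges :: "('v, 'l) lgraph \<Rightarrow> 'l set set" where
  "label_edges G =
     {{i, j} | i j. i \<in> labels G \<and> j \<in> labels G \<and> {vtx G i, vtx G j} \<in> edges G}"

text \<open>The graph \<open>G\<^sub>\<sigma>\<close>; vertices, label set and labeling are those of \<open>G\<close>.\<close>

definition permuted_graph :: "('v, 'l) lgraph \<Rightarrow> ('l \<Rightarrow> 'l) \<Rightarrow> ('v, 'l) lgraph" where
  "permuted_graph G \<sigma> = G\<lparr>edges :=
     {{vtx G i, vtx G j} | i j. i \<in> labels G \<and> j \<in> labels G \<and> {\<sigma> i, \<sigma> j} \<in> label_edges G}\<rparr>"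

definition Aut_labels :: "('v, 'l) lgraph \<Rightarrow> ('l \<Rightarrow> 'l) set" where
  "Aut_labels G = {\<sigma> \<in> carrier (BijGroup (labels G)). permuted_graph G \<sigma> = G}"

text \<open>
  \<open>Replace e e'\<close> stands for \<open>rs \<rightarrow> kl\<close> with \<open>e = {r, s}\<close> and \<open>e' = {k, l}\<close> sets of labels;
  \<open>Neutral\<close> stands for \<open>\<emptyset> \<rightarrow> \<emptyset>\<close>.
\<close>

datatype 'l replacement = Neutral | Replace "'l set" "'l set"

fun apply_replacement :: "('v, 'l) lgraph \<Rightarrow> 'l replacement \<Rightarrow> ('v, 'l) lgraph" where
  "apply_replacement G Neutral = G"
| "apply_replacement G (Replace e e') =
     G\<lparr>edges := (edges G - {vtx G ` e}) \<union> {vtx G ` e'}\<rparr>"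

definition edge_replacement :: "('v, 'l) lgraph \<Rightarrow> 'l set \<Rightarrow> 'l set \<Rightarrow> bool" where
  "edge_replacement G e e' \<longleftrightarrow>
     e \<subseteq> labels G \<and> e' \<subseteq> labels G \<and>
     vtx G ` e \<in> edges G \<and> vtx G ` e' \<in> complement_edges G \<union> {vtx G ` e}"

definition feasible :: "('v, 'l) lgraph \<Rightarrow> 'l set \<Rightarrow> 'l set \<Rightarrow> bool" where
  "feasible G e e' \<longleftrightarrow>
     edge_replacement G e e' \<and> graph_isomorphic (apply_replacement G (Replace e e')) G"

definition feasible_replacements :: "('v, 'l) lgraph \<Rightarrow> 'l replacement set" where
  "feasible_replacements G =
     {Replace e e' | e e'. feasible G e e' \<and> e \<noteq> e'} \<union> {Neutral}"

text \<open>For \<open>Neutral\<close> the following is literally \<^const>\<open>Aut_labels\<close>.\<close>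

definition Fer_set :: "('v, 'l) lgraph \<Rightarrow> 'l replacement \<Rightarrow> ('l \<Rightarrow> 'l) set" where
  "Fer_set G \<rho> =
     {\<sigma> \<in> carrier (BijGroup (labels G)). permuted_graph G \<sigma> = apply_replacement G \<rho>}"

definition fer_perms :: "('v, 'l) lgraph \<Rightarrow> ('l \<Rightarrow> 'l) set" where
  "fer_perms G = (\<Union>\<rho> \<in> feasible_replacements G. Fer_set G \<rho>)"

definition fer_perms_fixing :: "('v, 'l) lgraph \<Rightarrow> 'l \<Rightarrow> ('l \<Rightarrow> 'l) set" where
  "fer_perms_fixing G i = {\<sigma> \<in> fer_perms G. \<sigma> i = i}"

definition Fer_fixing :: "('v, 'l) lgraph \<Rightarrow> 'l \<Rightarrow> ('l \<Rightarrow> 'l) monoid" where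
  "Fer_fixing G i = subgroup_generated (BijGroup (labels G)) (fer_perms_fixing G i)"

definition stem_symmetric :: "('v, 'l) lgraph \<Rightarrow> 'l \<Rightarrow> bool" where
  "stem_symmetric G i \<longleftrightarrow> Fer_fixing G i \<cong> sym_group (card (verts G) - 1)"

definition hang_group :: "('v, 'l) lgraph \<Rightarrow> 'l \<Rightarrow> ('l \<Rightarrow> 'l) monoid" where
  "hang_group G i =
     subgroup_generated (BijGroup (labels G)) (fer_perms_fixing G i \<union> Aut_labels G)"

definition hang_symmetric :: "('v, 'l) lgraph \<Rightarrow> 'l \<Rightarrow> bool" where
  "hang_symmetric G i \<longleftrightarrow> hang_group G i = BijGroup (labels G)"

text \<open>\<open>G\<^sup>\<dagger>\<close> for a graph \<open>G\<close> with root \<open>r\<close>: a new vertex \<open>w\<close> labeled \<open>i\<close>, joined to \<open>r\<close> only.\<close>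

definition attach_leaf :: "('v, 'l) lgraph \<Rightarrow> 'v \<Rightarrow> 'v \<Rightarrow> 'l \<Rightarrow> ('v, 'l) lgraph" where
  "attach_leaf G r w i =
     \<lparr>verts = insert w (verts G), edges = insert {r, w} (edges G),
      labels = insert i (labels G), lab = (lab G)(w := i)\<rparr>"

text \<open>The permutation \<open>\<sigma> \<union> id\<close>, for \<open>i\<close> outside the label set of \<open>\<sigma>\<close>.\<close>

definition extend_perm :: "'l \<Rightarrow> ('l \<Rightarrow> 'l) \<Rightarrow> ('l \<Rightarrow> 'l)" where
  "extend_perm i \<sigma> = \<sigma>(i := i)"

end

theory Submission
  imports Defs
begin

text \<open>
  Let \<open>\<sigma> = \<tau> \<union> id\<close> and \<open>k = \<tau>\<inverse>(j)\<close>. The only edge at \<open>i\<close> in \<open>G\<^sup>\<dagger>\<^sub>\<sigma>\<close> is \<open>ik\<close>, and deleting it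
  leaves \<open>G\<^sub>\<tau>\<close>. If \<open>k = j\<close>, then \<open>G\<^sup>\<dagger>\<^sub>\<sigma>\<close> and \<open>G\<^sup>\<dagger>\<close> differ exactly where \<open>G\<^sub>\<tau>\<close> and \<open>G\<close> do; if \<open>k \<noteq> j\<close>,
  then the replacement \<open>ij \<rightarrow> ik\<close> is already spent on the leaf edge, so \<open>\<tau>\<close> has to be an
  automorphism. This gives (i). Part (ii) follows since \<open>\<tau> \<mapsto> \<tau> \<union> id\<close> is an injective homomorphism
  matching the generators, and (iii) by comparing orders with the symmetric group.
\<close>

section \<open>Edge sets read on labels, and one-edge exchanges\<close>

definition pullback_edges :: "'l set \<Rightarrow> 'l set set \<Rightarrow> ('l \<Rightarrow> 'l) \<Rightarrow> 'l set set" where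
  "pullback_edges X L \<sigma> = {A. A \<subseteq> X \<and> \<sigma> ` A \<in> L}"

text \<open>A non-neutral edge-replacement turning \<open>L\<close> into \<open>M\<close>, without
  the isomorphism requirement. The condition \<open>e' \<notin> L\<close> covers both that the added
  pair is a non-edge and that it differs from the removed one.\<close>

definition exchange :: "'l set \<Rightarrow> 'l set set \<Rightarrow> 'l set set \<Rightarrow> bool" where
  "exchange X L M \<longleftrightarrow>
     (\<exists>e \<in> L. \<exists>e'. e' \<subseteq> X \<and> card e' = 2 \<and> e' \<notin> L \<and> M = insert e' (L - {e}))"

lemma pullback_edges_subset_Pow: "pullback_edges X L \<sigma> \<subseteq> Pow X"
  by (auto simp: pullback_edges_def)

lemma label_edges_subset_Pow: "label_edges G \<subseteq> Pow (labels G)"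
  by (auto simp: label_edges_def)

text \<open>No member of \<open>L\<close> or \<open>M\<close> contains \<open>i\<close>, so the leaf
  edges can be compared separately from the rest. A common leaf edge leaves the exchange to take
  place inside \<open>Y\<close>; different leaf edges force the exchange to be the one between
  them.\<close>

lemma exchange_attach_edge:
  assumes L: "L \<subseteq> Pow Y" and M: "M \<subseteq> Pow Y" and i: "i \<notin> Y" and jk: "j \<in> Y" "k \<in> Y"
  shows "exchange (insert i Y) (insert {i, j} L) (insert {i, k} M) \<longleftrightarrow>
      exchange Y L M \<and> k = j \<or> M = L \<and> k \<noteq> j" (is "?l \<longleftrightarrow> ?r")
proof -
  have nL: "{i, x} \<notin> L" and nM: "{i, x} \<notin> M" for x
    using L M i by auto
  show ?thesis
  proof
    assume ?l
    then obtain e e' where e: "e \<in> insert {i, j} L" and e': "e' \<subseteq> insert i Y" "card e' = 2"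
        "e' \<notin> insert {i, j} L"
      and eq: "insert {i, k} M = insert e' (insert {i, j} L - {e})"
      unfolding exchange_def by metis
    show ?r
    proof (cases "k = j")
      case True
      \<comment> \<open>The leaf edge occurs on both sides and is not the added pair, so it is not
        the removed one either.\<close>
      have "{i, j} \<in> insert e' (insert {i, j} L - {e})" using True unfolding eq[symmetric] by simp
      then have ne: "e \<noteq> {i, j}" using e' by auto
      have "e' \<in> insert {i, k} M" unfolding eq by simp
      then have "e' \<in> M" using e' True by simp
      then have "e' \<subseteq> Y" using M by auto
      moreover have "M = insert e' (L - {e})"
      proof -
        have "M = insert {i, k} M - {{i, j}}" using nM True by auto
        also have "\<dots> = insert e' (L - {e})" unfolding eq using e' nL by auto
        finally show ?thesis .
      qed
      ultimately show ?thesis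
        unfolding exchange_def using e e' ne True by auto
    next
      case False
      then have kj: "{i, k} \<noteq> {i, j}" by (metis doubleton_eq_iff)
      \<comment> \<open>\<open>{i, k}\<close> is new, hence it is the added pair;
        \<open>{i, j}\<close> has disappeared, hence it is the removed one. Nothing is left to
        distinguish \<open>M\<close> from \<open>L\<close>.\<close>
      have "{i, k} \<in> insert e' (insert {i, j} L - {e})" unfolding eq[symmetric] by simp
      then have "e' = {i, k}" using kj nL by auto
      moreover have "{i, j} \<notin> insert {i, k} M" using kj nM by auto
      then have "e = {i, j}" unfolding eq by simp
      moreover have "M = insert {i, k} M - {{i, k}}" using nM by auto
      ultimately have "M = L" unfolding eq using nL by auto
      with False show ?thesis by simp
    qed
  next
    assume ?r
    then show ?l
    proof
      assume "exchange Y L M \<and> k = j"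
      then obtain e e' where e: "e \<in> L" "e' \<subseteq> Y" "card e' = 2" "e' \<notin> L" "M = insert e' (L - {e})"
        and k: "k = j"
        unfolding exchange_def by metis
      then have "e' \<noteq> {i, j}" "e \<noteq> {i, j}" using i nL by auto
      then have "insert {i, k} M = insert e' (insert {i, j} L - {e})"
        using e(5) k by auto
      then show ?l
        unfolding exchange_def using e(1-4) \<open>e' \<noteq> {i, j}\<close>
        by (intro bexI[of _ e] exI[of _ e']) auto
    next
      assume a: "M = L \<and> k \<noteq> j"
      then have kj: "{i, k} \<noteq> {i, j}" by (metis doubleton_eq_iff)
      have "card {i, k} = 2" using i jk by (metis card_2_iff)
      moreover have "insert {i, k} M = insert {i, k} (insert {i, j} L - {{i, j}})"
        using a nL by auto
      ultimately show ?l
        unfolding exchange_def using kj nL jk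
        by (intro bexI[of _ "{i, j}"] exI[of _ "{i, k}"]) auto
    qed
  qed
qed

text \<open>The extended permutation fixes \<open>i\<close> and sends \<open>k\<close> to
  \<open>j\<close>, so \<open>{i, k}\<close> is the preimage of the leaf edge. It preserves whether
  a set contains \<open>i\<close>, so all other edges pull back under \<open>\<tau>\<close>
  alone.\<close>

lemma pullback_edges_extend_perm:
  assumes L: "L \<subseteq> Pow Y" and i: "i \<notin> Y" and \<tau>: "\<tau> \<in> Bij Y" and k: "k \<in> Y" "\<tau> k = j"
  shows "pullback_edges (insert i Y) (insert {i, j} L) (extend_perm i \<tau>)
    = insert {i, k} (pullback_edges Y L \<tau>)"
proof -
  have bij: "bij_betw \<tau> Y Y" using \<tau> by (simp add: Bij_def)
  then have inj: "inj_on \<tau> Y" and im: "\<tau> ` Y = Y" by (auto simp: bij_betw_def)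
  have ext: "extend_perm i \<tau> ` A = \<tau> ` A" if "A \<subseteq> Y" for A
    using that i by (auto simp: extend_perm_def intro!: image_cong)
  have "j \<in> Y" using k im by blast
  show ?thesis
  proof (rule Set.set_eqI)
    fix A
    show "A \<in> pullback_edges (insert i Y) (insert {i, j} L) (extend_perm i \<tau>) \<longleftrightarrow>
        A \<in> insert {i, k} (pullback_edges Y L \<tau>)"
    proof (cases "i \<in> A")
      case False
      then have "A \<subseteq> insert i Y \<longleftrightarrow> A \<subseteq> Y" and "A \<noteq> {i, k}" by auto
      moreover have "\<tau> ` A \<noteq> {i, j}" if "A \<subseteq> Y" using that im i by blast
      ultimately show ?thesis by (auto simp: pullback_edges_def ext)
    next
      case True
      \<comment> \<open>Stripping \<open>i\<close> reduces the claim to \<open>\<tau>\<close>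
        applied to \<open>B\<close> being \<open>{j}\<close>, which injectivity turns into
        \<open>B = {k}\<close>.\<close>
      define B where "B = A - {i}"
      have A: "A = insert i B" and iB: "i \<notin> B" using True by (auto simp: B_def)
      have "A \<notin> pullback_edges Y L \<tau>" using True i by (auto simp: pullback_edges_def)
      moreover have "A \<in> pullback_edges (insert i Y) (insert {i, j} L) (extend_perm i \<tau>) \<longleftrightarrow>
          A = {i, k}"
      proof (cases "B \<subseteq> Y")
        case False
        then show ?thesis using A iB k by (auto simp: pullback_edges_def)
      next
        case BY: True
        have "extend_perm i \<tau> ` A = insert i (\<tau> ` B)"
          using ext[OF BY] A by (auto simp: extend_perm_def)
        moreover have "insert i (\<tau> ` B) \<notin> L" using L i by auto
        moreover have "i \<notin> \<tau> ` B" using BY im i by blast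
        then have "insert i (\<tau> ` B) = {i, j} \<longleftrightarrow> \<tau> ` B = \<tau> ` {k}"
          using i \<open>j \<in> Y\<close> k by auto
        moreover have "\<tau> ` B = \<tau> ` {k} \<longleftrightarrow> B = {k}"
          using inj_on_image_eq_iff[OF inj BY, of "{k}"] k by auto
        moreover have "A = {i, k} \<longleftrightarrow> B = {k}" using A iB i k by auto
        moreover have "A \<subseteq> insert i Y" using A BY by auto
        ultimately show ?thesis by (auto simp: pullback_edges_def)
      qed
      ultimately show ?thesis by auto
    qed
  qed
qed

section \<open>Translation of graphs and replacements to label sets\<close>

context
  fixes G :: "('v, 'l) lgraph"
  assumes G: "labeled_graph G"
begin

lemma bij_betw_vtx: "bij_betw (vtx G) (labels G) (verts G)"
  using G bij_betw_inv_into unfolding labeled_graph_def vtx_def by blast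

lemma edges_subset_verts: "E \<in> edges G \<Longrightarrow> E \<subseteq> verts G"
  and card_edge: "E \<in> edges G \<Longrightarrow> card E = 2"
  using G by (auto simp: labeled_graph_def simple_graph_def)

lemma image_vtx_eq_iff:
  "A \<subseteq> labels G \<Longrightarrow> B \<subseteq> labels G \<Longrightarrow> vtx G ` A = vtx G ` B \<longleftrightarrow> A = B"
  using bij_betw_vtx by (auto simp: bij_betw_def inj_on_image_eq_iff)

lemma card_image_vtx: "A \<subseteq> labels G \<Longrightarrow> card (vtx G ` A) = card A"
  using bij_betw_vtx by (metis bij_betw_def card_image inj_on_subset)

lemma image_vtx_subset: "A \<subseteq> labels G \<Longrightarrow> vtx G ` A \<subseteq> verts G"
  using bij_betw_vtx by (auto simp: bij_betw_def)

text \<open>Edges have two elements and \<open>vtx G\<close> is injective on labels, so a label set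
  mapped onto an edge is automatically a pair.\<close>

lemma label_edges_eq: "label_edges G = {A. A \<subseteq> labels G \<and> vtx G ` A \<in> edges G}"
proof (intro Set.set_eqI iffI)
  fix A assume "A \<in> {A. A \<subseteq> labels G \<and> vtx G ` A \<in> edges G}"
  then have A: "A \<subseteq> labels G" "vtx G ` A \<in> edges G" by auto
  then have "card A = 2" using card_edge card_image_vtx by metis
  then obtain x y where "A = {x, y}" by (auto simp: card_2_iff)
  then show "A \<in> label_edges G" using A unfolding label_edges_def by auto
qed (auto simp: label_edges_def)

lemma card_label_edge: "A \<in> label_edges G \<Longrightarrow> card A = 2"
  using card_edge card_image_vtx by (force simp: label_edges_eq)

lemma edges_eq_image: "edges G = (\<lambda>A. vtx G ` A) ` label_edges G"
proof -
  have "\<exists>A. A \<subseteq> labels G \<and> vtx G ` A = E" if "E \<in> edges G" for E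
    using edges_subset_verts[OF that] bij_betw_vtx by (metis bij_betw_def subset_image_iff)
  then show ?thesis by (auto simp: label_edges_eq image_iff) metis
qed

text \<open>This is what allows equations between edge sets to be decided on labels.\<close>

lemma inj_on_image_vtx: "inj_on (\<lambda>A. vtx G ` A) (Pow (labels G))"
  by (intro inj_onI) (auto simp: image_vtx_eq_iff)

lemma edges_permuted_graph:
  assumes "\<sigma> \<in> Bij (labels G)"
  shows "edges (permuted_graph G \<sigma>)
    = (\<lambda>A. vtx G ` A) ` pullback_edges (labels G) (label_edges G) \<sigma>"
proof -
  have inj: "inj_on \<sigma> (labels G)" using assms by (auto simp: Bij_def bij_betw_def)
  \<comment> \<open>The definition of \<open>permuted_graph\<close> only builds sets of the form
    \<open>{x, y}\<close>, so preimages of edges must first be recognised as pairs.\<close>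
  have *: "\<exists>x y. A = {x, y}" if "A \<subseteq> labels G" "\<sigma> ` A \<in> label_edges G" for A
  proof -
    have "card A = 2"
      using card_label_edge[OF that(2)] card_image inj inj_on_subset that(1) by metis
    then show ?thesis by (auto simp: card_2_iff)
  qed
  show ?thesis
  proof (intro Set.set_eqI iffI)
    fix E assume "E \<in> edges (permuted_graph G \<sigma>)"
    then obtain x y where "E = vtx G ` {x, y}" "{x, y} \<subseteq> labels G" "\<sigma> ` {x, y} \<in> label_edges G"
      by (auto simp: permuted_graph_def)
    then show "E \<in> (\<lambda>A. vtx G ` A) ` pullback_edges (labels G) (label_edges G) \<sigma>"
      unfolding pullback_edges_def by blast
  next
    fix E assume "E \<in> (\<lambda>A. vtx G ` A) ` pullback_edges (labels G) (label_edges G) \<sigma>"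
    then obtain A where A: "E = vtx G ` A" "A \<subseteq> labels G" "\<sigma> ` A \<in> label_edges G"
      by (auto simp: pullback_edges_def)
    with *[of A] obtain x y where "A = {x, y}" by blast
    with A show "E \<in> edges (permuted_graph G \<sigma>)" by (auto simp: permuted_graph_def)
  qed
qed

text \<open>Permuting changes the edge field only, so equality of the records comes down to equality
  of edge sets.\<close>

lemma permuted_graph_eq_update_iff:
  "permuted_graph G \<sigma> = G\<lparr>edges := E\<rparr> \<longleftrightarrow> edges (permuted_graph G \<sigma>) = E"
  by (cases G) (simp add: permuted_graph_def)

lemma permuted_graph_eq_self_iff:
  assumes "\<sigma> \<in> Bij (labels G)"
  shows "permuted_graph G \<sigma> = G \<longleftrightarrow>
    pullback_edges (labels G) (label_edges G) \<sigma> = label_edges G"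
proof -
  have "permuted_graph G \<sigma> = G \<longleftrightarrow> edges (permuted_graph G \<sigma>) = edges G"
    using permuted_graph_eq_update_iff[of \<sigma> "edges G"] by simp
  also have "\<dots> \<longleftrightarrow> pullback_edges (labels G) (label_edges G) \<sigma> = label_edges G"
    unfolding edges_permuted_graph[OF assms] edges_eq_image
    by (rule inj_on_image_eq_iff[OF inj_on_image_vtx pullback_edges_subset_Pow
        label_edges_subset_Pow])
  finally show ?thesis .
qed

lemma permuted_graph_eq_replace_iff:
  assumes "\<sigma> \<in> Bij (labels G)" and e: "e \<subseteq> labels G" and e': "e' \<subseteq> labels G"
  shows "permuted_graph G \<sigma> = apply_replacement G (Replace e e') \<longleftrightarrow>
    pullback_edges (labels G) (label_edges G) \<sigma> = insert e' (label_edges G - {e})"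
proof -
  have "permuted_graph G \<sigma> = apply_replacement G (Replace e e') \<longleftrightarrow>
      edges (permuted_graph G \<sigma>) = edges G - {vtx G ` e} \<union> {vtx G ` e'}"
    unfolding apply_replacement.simps by (rule permuted_graph_eq_update_iff)
  also have "edges G - {vtx G ` e} \<union> {vtx G ` e'}
      = (\<lambda>A. vtx G ` A) ` insert e' (label_edges G - {e})"
  proof -
    have "(\<lambda>A. vtx G ` A) ` (label_edges G - {e}) = edges G - {vtx G ` e}"
      unfolding edges_eq_image
      using inj_on_image_set_diff[OF inj_on_image_vtx, of "label_edges G" "{e}"]
        label_edges_subset_Pow e by auto
    then show ?thesis by auto
  qed
  also have "edges (permuted_graph G \<sigma>) = \<dots> \<longleftrightarrow>
      pullback_edges (labels G) (label_edges G) \<sigma> = insert e' (label_edges G - {e})"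
    unfolding edges_permuted_graph[OF assms(1)]
    by (rule inj_on_image_eq_iff[OF inj_on_image_vtx pullback_edges_subset_Pow])
      (use label_edges_subset_Pow e' in auto)
  finally show ?thesis .
qed

text \<open>The isomorphism sends the vertex labeled \<open>x\<close> to the vertex labeled
  \<open>\<sigma> x\<close>.\<close>

lemma graph_isomorphic_permuted_graph:
  assumes "\<sigma> \<in> Bij (labels G)"
  shows "graph_isomorphic (permuted_graph G \<sigma>) G"
proof -
  let ?f = "\<lambda>v. vtx G (\<sigma> (lab G v))"
  have lab: "bij_betw (lab G) (verts G) (labels G)" using G by (simp add: labeled_graph_def)
  have \<sigma>: "bij_betw \<sigma> (labels G) (labels G)" using assms by (simp add: Bij_def)
  have "bij_betw ?f (verts G) (verts G)"
    using bij_betw_trans[OF bij_betw_trans[OF lab \<sigma>] bij_betw_vtx] by (simp add: comp_def)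
  moreover have "{u, v} \<in> edges (permuted_graph G \<sigma>) \<longleftrightarrow> {?f u, ?f v} \<in> edges G"
    if "u \<in> verts G" "v \<in> verts G" for u v
  proof -
    let ?A = "{lab G u, lab G v}"
    have A: "?A \<subseteq> labels G" using that lab by (auto simp: bij_betw_def)
    have uv: "{u, v} = vtx G ` ?A"
      using that lab by (simp add: vtx_def bij_betw_def)
    have "{u, v} \<in> edges (permuted_graph G \<sigma>) \<longleftrightarrow>
        ?A \<in> pullback_edges (labels G) (label_edges G) \<sigma>"
      unfolding edges_permuted_graph[OF assms] uv
      by (rule inj_on_image_mem_iff[OF inj_on_image_vtx _ pullback_edges_subset_Pow])
        (use A in auto)
    also have "\<dots> \<longleftrightarrow> vtx G ` \<sigma> ` ?A \<in> edges G"
      using A \<sigma> by (auto simp: pullback_edges_def label_edges_eq bij_betw_def)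
    finally show ?thesis by simp
  qed
  ultimately show ?thesis
    unfolding graph_isomorphic_def by (intro exI[of _ ?f]) (auto simp: permuted_graph_def)
qed

lemma Aut_labels_iff:
  "\<sigma> \<in> Aut_labels G \<longleftrightarrow> \<sigma> \<in> Bij (labels G) \<and>
    pullback_edges (labels G) (label_edges G) \<sigma> = label_edges G"
  using permuted_graph_eq_self_iff by (auto simp: Aut_labels_def BijGroup_def)

text \<open>Feasibility imposes no condition: \<open>\<sigma>\<close> itself is an isomorphism from \<open>G\<^sub>\<sigma>\<close> to \<open>G\<close>.\<close>

lemma fer_perms_iff:
  "\<sigma> \<in> fer_perms G \<longleftrightarrow> \<sigma> \<in> Bij (labels G) \<and>
    (pullback_edges (labels G) (label_edges G) \<sigma> = label_edges G \<or>
     exchange (labels G) (label_edges G) (pullback_edges (labels G) (label_edges G) \<sigma>))"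
proof (cases "\<sigma> \<in> Bij (labels G)")
  case True
  let ?P = "pullback_edges (labels G) (label_edges G) \<sigma>"
  have "\<sigma> \<in> fer_perms G \<longleftrightarrow>
      (\<exists>\<rho> \<in> feasible_replacements G. permuted_graph G \<sigma> = apply_replacement G \<rho>)"
    using True by (simp add: fer_perms_def Fer_set_def BijGroup_def)
  also have "\<dots> \<longleftrightarrow> permuted_graph G \<sigma> = G \<or>
      (\<exists>e e'. feasible G e e' \<and> e \<noteq> e' \<and>
        permuted_graph G \<sigma> = apply_replacement G (Replace e e'))"
    unfolding feasible_replacements_def by (auto simp del: apply_replacement.simps(2))
  also have "(\<exists>e e'. feasible G e e' \<and> e \<noteq> e' \<and>
        permuted_graph G \<sigma> = apply_replacement G (Replace e e')) \<longleftrightarrow>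
      (\<exists>e e'. edge_replacement G e e' \<and> e \<noteq> e' \<and>
        permuted_graph G \<sigma> = apply_replacement G (Replace e e'))"
    using graph_isomorphic_permuted_graph[OF True] unfolding feasible_def by metis
  also have "\<dots> \<longleftrightarrow> (\<exists>e e'. edge_replacement G e e' \<and> e \<noteq> e' \<and>
      ?P = insert e' (label_edges G - {e}))"
    by (intro ex_cong1 conj_cong refl permuted_graph_eq_replace_iff[OF True])
      (auto simp: edge_replacement_def)
  also have "\<dots> \<longleftrightarrow> exchange (labels G) (label_edges G) ?P"
  proof -
    \<comment> \<open>An edge-replacement may put back the removed edge;
      \<open>e \<noteq> e'\<close> rules this out and leaves exactly the non-edges for
      \<open>e'\<close>.\<close>
    have "edge_replacement G e e' \<and> e \<noteq> e' \<longleftrightarrow>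
        e \<in> label_edges G \<and> e' \<subseteq> labels G \<and> card e' = 2 \<and> e' \<notin> label_edges G" for e e'
    proof (cases "e \<subseteq> labels G \<and> e' \<subseteq> labels G")
      case True
      then show ?thesis
        by (auto simp: edge_replacement_def complement_edges_def label_edges_eq
            image_vtx_eq_iff card_image_vtx image_vtx_subset)
    next
      case False
      then show ?thesis by (auto simp: edge_replacement_def label_edges_eq)
    qed
    then show ?thesis unfolding exchange_def by metis
  qed
  finally show ?thesis using True permuted_graph_eq_self_iff by auto
next
  case False
  then show ?thesis by (auto simp: fer_perms_def Fer_set_def BijGroup_def)
qed

section \<open>The graph with the leaf attached\<close>

context
  fixes r w :: 'v and i :: 'l
  assumes r: "r \<in> verts G" and w: "w \<notin> verts G" and i: "i \<notin> labels G"
begin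

lemma labeled_graph_attach_leaf: "labeled_graph (attach_leaf G r w i)"
proof -
  have "bij_betw (lab G) (verts G) (labels G)" using G by (simp add: labeled_graph_def)
  then have "bij_betw ((lab G)(w := i)) (verts G) (labels G)"
    by (rule bij_betw_cong[THEN iffD1, rotated]) (use w in auto)
  then have "bij_betw ((lab G)(w := i)) (insert w (verts G)) (insert i (labels G))"
    using notIn_Un_bij_betw[of w "verts G" "(lab G)(w := i)" "labels G"] w i by auto
  moreover have "card {r, w} = 2"
    using r w by (metis card_2_iff)
  ultimately show ?thesis
    using G r w by (auto simp: labeled_graph_def simple_graph_def attach_leaf_def)
qed

text \<open>\<open>vtx\<close> is an inverse chosen relative to the vertex set and labeling, so it
  has to be recomputed for the larger graph. The proposed vertex carries the label \<open>x\<close>,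
  and the labeling is injective.\<close>

lemma vtx_attach_leaf:
  assumes "x \<in> insert i (labels G)"
  shows "vtx (attach_leaf G r w i) x = (if x = i then w else vtx G x)"
proof -
  let ?H = "attach_leaf G r w i"
  have H: "inj_on (lab ?H) (verts ?H)"
    using labeled_graph_attach_leaf by (auto simp: labeled_graph_def bij_betw_def)
  have lab: "bij_betw (lab G) (verts G) (labels G)" using G by (simp add: labeled_graph_def)
  let ?v = "if x = i then w else vtx G x"
  have "?v \<in> verts ?H" "lab ?H ?v = x"
    using assms lab w i bij_betw_vtx
    by (auto simp: attach_leaf_def bij_betw_def vtx_def f_inv_into_f inv_into_into)
  then show ?thesis using inv_into_f_f[OF H, of ?v] by (simp add: vtx_def[of ?H])
qed

text \<open>A label set containing \<open>i\<close> has \<open>w\<close> in its image, so it can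
  only give the new edge; on the other label sets both graphs have the same vertices and
  edges.\<close>

lemma label_edges_attach_leaf:
  "label_edges (attach_leaf G r w i) = insert {i, lab G r} (label_edges G)"
proof -
  let ?H = "attach_leaf G r w i"
  have lab: "bij_betw (lab G) (verts G) (labels G)" using G by (simp add: labeled_graph_def)
  have j: "lab G r \<in> labels G" "vtx G (lab G r) = r"
    using lab r by (auto simp: bij_betw_def vtx_def)
  have im: "vtx ?H ` A = vtx G ` A" if "A \<subseteq> labels G" for A
    using that i by (intro image_cong) (auto simp: vtx_attach_leaf)
  have labels: "labels ?H = insert i (labels G)" and edges: "edges ?H = insert {r, w} (edges G)"
    by (auto simp: attach_leaf_def)
  have ij: "vtx ?H ` {i, lab G r} = {r, w}"
    using j i by (auto simp: vtx_attach_leaf)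
  have wV: "{r, w} \<noteq> vtx G ` A" if "A \<subseteq> labels G" for A
    using image_vtx_subset[OF that] w by blast
  have "A = {i, lab G r} \<or> A \<in> label_edges G"
    if A: "A \<subseteq> insert i (labels G)" "vtx ?H ` A \<in> insert {r, w} (edges G)" for A
  proof (cases "i \<in> A")
    case True
    then have "w \<in> vtx ?H ` A" by (force simp: vtx_attach_leaf)
    then have "vtx ?H ` A \<notin> edges G" using edges_subset_verts w by blast
    then have "vtx ?H ` A = {r, w}" using A(2) by simp
    then have "vtx ?H ` A = vtx ?H ` {i, lab G r}" using ij by simp
    moreover have "inj_on (vtx ?H) (insert i (labels G))"
      \<comment> \<open>The qualified name gives the fact for an arbitrary labeled graph; the local
        one is tied to \<open>G\<close>.\<close>
      using Submission.bij_betw_vtx[OF labeled_graph_attach_leaf] labels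
      by (auto simp: bij_betw_def)
    ultimately have "A = {i, lab G r}"
      using inj_on_image_eq_iff A j by (metis insert_subset insertI1 insertI2 empty_subsetI)
    then show ?thesis ..
  next
    case False
    then have "A \<subseteq> labels G" using A by auto
    then have "vtx G ` A \<in> edges G" using A(2) im[of A] wV[of A] by auto
    then show ?thesis using \<open>A \<subseteq> labels G\<close> by (simp add: label_edges_eq)
  qed
  moreover have "A \<subseteq> insert i (labels G) \<and> vtx ?H ` A \<in> insert {r, w} (edges G)"
    if "A = {i, lab G r} \<or> A \<in> label_edges G" for A
    using that ij j im by (auto simp: label_edges_eq)
  ultimately have "A \<subseteq> insert i (labels G) \<and> vtx ?H ` A \<in> insert {r, w} (edges G) \<longleftrightarrow>
      A = {i, lab G r} \<or> A \<in> label_edges G" for A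
    by metis
  then show ?thesis
    unfolding Submission.label_edges_eq[OF labeled_graph_attach_leaf] labels edges
    by (intro Set.set_eqI) simp
qed

end

end

section \<open>Extending permutations by a fixed point\<close>

lemma extend_perm_Bij:
  assumes "i \<notin> Y" "\<tau> \<in> Bij Y"
  shows "extend_perm i \<tau> \<in> Bij (insert i Y)"
proof -
  have "bij_betw (extend_perm i \<tau>) Y Y"
    using assms by (auto simp: Bij_def extend_perm_def intro: bij_betw_cong[THEN iffD1, rotated])
  then have "bij_betw (extend_perm i \<tau>) (insert i Y) (insert i Y)"
    using notIn_Un_bij_betw[of i Y "extend_perm i \<tau>" Y] assms by (auto simp: extend_perm_def)
  then show ?thesis
    using assms by (auto simp: Bij_def extend_perm_def extensional_def)
qed

text \<open>Supplies surjectivity in (i). The witness is \<open>restrict \<sigma> Y\<close>, because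
  members of \<open>Bij Y\<close> must be \<open>undefined\<close> outside \<open>Y\<close>, in
  particular at \<open>i\<close>.\<close>

lemma Bij_fixing_extend_perm:
  assumes "i \<notin> Y" "\<sigma> \<in> Bij (insert i Y)" "\<sigma> i = i"
  obtains \<tau> where "\<tau> \<in> Bij Y" "\<sigma> = extend_perm i \<tau>"
proof
  have "bij_betw \<sigma> (insert i Y) (insert i Y)" using assms by (simp add: Bij_def)
  then have "bij_betw \<sigma> Y Y"
    using notIn_Un_bij_betw3[of i Y \<sigma> Y] assms by auto
  then have "bij_betw (restrict \<sigma> Y) Y Y"
    by (rule bij_betw_cong[THEN iffD1, rotated]) auto
  then show "restrict \<sigma> Y \<in> Bij Y" by (auto simp: Bij_def)
  show "\<sigma> = extend_perm i (restrict \<sigma> Y)"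
    using assms by (auto simp: extend_perm_def Bij_def extensional_def fun_eq_iff)
qed

lemma inj_on_extend_perm:
  assumes "i \<notin> Y"
  shows "inj_on (extend_perm i) (Bij Y)"
proof (rule inj_onI)
  fix \<sigma> \<tau> assume *: "\<sigma> \<in> Bij Y" "\<tau> \<in> Bij Y" "extend_perm i \<sigma> = extend_perm i \<tau>"
  show "\<sigma> = \<tau>"
  proof
    fix x
    show "\<sigma> x = \<tau> x"
    proof (cases "x = i")
      \<comment> \<open>The extensions carry no information at \<open>i\<close>; there both
        permutations are \<open>undefined\<close>, since \<open>i\<close> lies outside
        \<open>Y\<close>.\<close>
      case True
      then show ?thesis using *(1,2) assms by (simp add: Bij_def extensional_def)
    next
      case False
      then show ?thesis using fun_cong[OF *(3), of x] by (simp add: extend_perm_def)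
    qed
  qed
qed

text \<open>On \<open>Y\<close> the inner permutation stays in \<open>Y\<close> and so never reaches
  \<open>i\<close>, where the outer one was changed; at \<open>i\<close> both sides give
  \<open>i\<close>.\<close>

lemma group_hom_extend_perm:
  assumes "i \<notin> Y"
  shows "group_hom (BijGroup Y) (BijGroup (insert i Y)) (extend_perm i)"
proof -
  have "extend_perm i (compose Y \<sigma> \<tau>) = compose (insert i Y) (extend_perm i \<sigma>) (extend_perm i \<tau>)"
    if "\<sigma> \<in> Bij Y" "\<tau> \<in> Bij Y" for \<sigma> \<tau>
  proof
    fix x
    show "extend_perm i (compose Y \<sigma> \<tau>) x
        = compose (insert i Y) (extend_perm i \<sigma>) (extend_perm i \<tau>) x"
      using that assms Bij_imp_funcset[OF that(2)]
      by (auto simp: extend_perm_def compose_def)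
  qed
  then have "extend_perm i \<in> hom (BijGroup Y) (BijGroup (insert i Y))"
    using extend_perm_Bij[OF assms] by (auto simp: hom_def BijGroup_def)
  then show ?thesis
    by (simp add: group_hom_def group_hom_axioms_def group_BijGroup)
qed

section \<open>Comparison with the symmetric group\<close>

lemma BijGroup_iso_sym_group:
  assumes "finite Y"
  shows "BijGroup Y \<cong> sym_group (card Y)"
proof -
  let ?N = "{1..card Y}"
  obtain b where b: "bij_betw b ?N Y"
    using assms ex_bij_betw_nat_finite_1 by blast
  define c where "c = inv_into ?N b"
  have c: "bij_betw c Y ?N" using b c_def bij_betw_inv_into by blast
  have cb: "c (b x) = x" if "x \<in> ?N" for x
    using that b by (simp add: c_def bij_betw_def)
  have bc: "b (c y) = y" if "y \<in> Y" for y
    using that b by (simp add: c_def bij_betw_def f_inv_into_f)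
  have bY: "b x \<in> Y" if "x \<in> ?N" for x using that b bij_betwE by blast
  have cN: "c y \<in> ?N" if "y \<in> Y" for y using that c bij_betwE by blast
  \<comment> \<open>Both maps conjugate by the numbering \<open>b\<close>. They also switch
    conventions outside the domain: members of \<open>sym_group\<close> are the identity there,
    members of \<open>BijGroup\<close> are \<open>undefined\<close>.\<close>
  define \<phi> where "\<phi> f = (\<lambda>x. if x \<in> ?N then c (f (b x)) else x)" for f
  define \<psi> where "\<psi> p = restrict (\<lambda>y. b (p (c y))) Y" for p
  have \<phi>: "\<phi> f permutes ?N" if "f \<in> Bij Y" for f
  proof (rule bij_imp_permutes)
    have f: "bij_betw f Y Y" using that by (simp add: Bij_def)
    have "bij_betw (\<lambda>x. c (f (b x))) ?N ?N"
      using bij_betw_trans[OF bij_betw_trans[OF b f] c] by (simp add: comp_def)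
    then show "bij_betw (\<phi> f) ?N ?N"
      by (rule bij_betw_cong[THEN iffD1, rotated]) (simp add: \<phi>_def)
  qed (auto simp: \<phi>_def)
  have \<psi>: "\<psi> p \<in> Bij Y" if "p permutes ?N" for p
  proof -
    have "bij_betw (\<lambda>y. b (p (c y))) Y Y"
      using bij_betw_trans[OF bij_betw_trans[OF c permutes_imp_bij[OF that]] b]
      by (simp add: comp_def)
    then have "bij_betw (\<psi> p) Y Y"
      by (rule bij_betw_cong[THEN iffD1, rotated]) (simp add: \<psi>_def)
    then show ?thesis by (simp add: Bij_def \<psi>_def)
  qed
  have "\<phi> \<in> hom (BijGroup Y) (sym_group (card Y))"
  proof (rule homI)
    fix f g assume "f \<in> carrier (BijGroup Y)" "g \<in> carrier (BijGroup Y)"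
    then have fg: "f \<in> Bij Y" "g \<in> Bij Y" by (auto simp: BijGroup_def)
    have "\<phi> (compose Y f g) x = (\<phi> f \<circ> \<phi> g) x" for x
    proof (cases "x \<in> ?N")
      case True
      have gY: "g (b x) \<in> Y" using bY[OF True] Bij_imp_funcset[OF fg(2)] by blast
      show ?thesis
        using True bY[OF True] cN[OF gY] bc[OF gY]
        by (simp add: \<phi>_def compose_def del: atLeastAtMost_iff)
    qed (simp add: \<phi>_def del: atLeastAtMost_iff)
    then show "\<phi> (f \<otimes>\<^bsub>BijGroup Y\<^esub> g) = \<phi> f \<otimes>\<^bsub>sym_group (card Y)\<^esub> \<phi> g"
      using fg by (auto simp: BijGroup_def sym_group_def)
  qed (simp add: BijGroup_def sym_group_def \<phi> del: One_nat_def)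
  moreover have "bij_betw \<phi> (carrier (BijGroup Y)) (carrier (sym_group (card Y)))"
  proof (rule bij_betwI[where g = \<psi>])
    fix f assume "f \<in> carrier (BijGroup Y)"
    then have f: "f \<in> Bij Y" by (simp add: BijGroup_def)
    have fY: "f y \<in> Y" if "y \<in> Y" for y using that Bij_imp_funcset[OF f] by auto
    have und: "f y = undefined" if "y \<notin> Y" for y
      using that f by (simp add: Bij_def extensional_def)
    show "\<psi> (\<phi> f) = f"
    proof
      fix y
      show "\<psi> (\<phi> f) y = f y"
        using cN[of y] bc[of y] bc[OF fY[of y]] und[of y]
        by (cases "y \<in> Y") (auto simp: \<psi>_def \<phi>_def)
    qed
  next
    fix p assume "p \<in> carrier (sym_group (card Y))"
    then have p: "p permutes ?N" by (simp add: sym_group_def)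
    show "\<phi> (\<psi> p) = p"
    proof
      fix x
      show "\<phi> (\<psi> p) x = p x"
      proof (cases "x \<in> ?N")
        case True
        then have "p x \<in> ?N" using permutes_in_image[OF p] by blast
        then show ?thesis using True bY[OF True] cb by (simp add: \<phi>_def \<psi>_def)
      next
        case False
        then show ?thesis using permutes_not_in[OF p False]
          by (simp add: \<phi>_def del: atLeastAtMost_iff)
      qed
    qed
  qed (use \<phi> \<psi> in \<open>auto simp: BijGroup_def sym_group_def simp del: One_nat_def\<close>)
  ultimately show ?thesis by (auto simp: is_iso_def iso_def)
qed

text \<open>The hang group sits inside a finite group of the same order as the symmetric group, so
  an abstract isomorphism already forces it to be everything.\<close>

lemma hang_group_iso_sym_group_iff:
  assumes "finite (labels G)"
  shows "hang_group G j \<cong> sym_group (card (labels G)) \<longleftrightarrow> hang_symmetric G j"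
proof
  let ?B = "BijGroup (labels G)"
  interpret group ?B by (rule group_BijGroup)
  assume "hang_group G j \<cong> sym_group (card (labels G))"
  then have "card (carrier (hang_group G j)) = card (carrier ?B)"
    using iso_same_card BijGroup_iso_sym_group[OF assms] by metis
  moreover have "carrier (hang_group G j) \<subseteq> carrier ?B"
    unfolding hang_group_def by (rule carrier_subgroup_generated_subset)
  \<comment> \<open>An infinite carrier would have \<open>card\<close> equal to 0, but the
    isomorphism gives it the cardinality of \<open>sym_group\<close>, a factorial.\<close>
  moreover have "finite (carrier ?B)"
    by (rule ccontr) (use iso_same_card[OF BijGroup_iso_sym_group[OF assms]] in
        \<open>simp add: sym_group_card_carrier\<close>)
  ultimately have "carrier (hang_group G j) = carrier ?B" by (simp add: card_subset_eq)
  then show "hang_symmetric G j"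
    \<comment> \<open>\<open>subgroup_generated\<close> replaces only the carrier, so equal carriers
      give equal monoid records.\<close>
    by (simp add: hang_symmetric_def hang_group_def subgroup_generated_def)
next
  assume "hang_symmetric G j"
  then show "hang_group G j \<cong> sym_group (card (labels G))"
    using BijGroup_iso_sym_group[OF assms] by (simp add: hang_symmetric_def)
qed

section \<open>Matching generators, generated groups and orders\<close>

theorem proposition1:
  fixes G Gd :: "('v, 'l) lgraph" and Y :: "'l set" and r w :: 'v and i j :: 'l
  assumes "labeled_graph G" and "labels G = Y"
    and "r \<in> verts G" and "lab G r = j"
    and "w \<notin> verts G" and "i \<notin> Y"
    and "Gd = attach_leaf G r w i"
  shows "bij_betw (extend_perm i) (fer_perms_fixing G j \<union> Aut_labels G) (fer_perms_fixing Gd i)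
    \<and> extend_perm i \<in> iso (hang_group G j) (Fer_fixing Gd i)
    \<and> (stem_symmetric Gd i \<longleftrightarrow> hang_symmetric G j)"
proof -
  let ?S = "fer_perms_fixing G j \<union> Aut_labels G" and ?T = "fer_perms_fixing Gd i"
  let ?L = "label_edges G"
  have i: "i \<notin> labels G" using assms by simp
  note ctx = assms(1,3,5) i
  have Gd: "labeled_graph Gd" using labeled_graph_attach_leaf[OF ctx] assms(7) by simp
  have Xd: "labels Gd = insert i Y" using assms by (simp add: attach_leaf_def)
  have Ld: "label_edges Gd = insert {i, j} ?L"
    using label_edges_attach_leaf[OF ctx] assms by simp
  have j: "j \<in> Y" using assms by (auto simp: labeled_graph_def bij_betw_def)
  have L: "?L \<subseteq> Pow Y" using label_edges_subset_Pow assms by blast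
  have S: "?S \<subseteq> Bij Y"
    using assms(2) by (auto simp: fer_perms_fixing_def fer_perms_iff[OF assms(1)]
        Aut_labels_iff[OF assms(1)])
  \<comment> \<open>This equivalence is the content of (i); bijectivity then only needs injectivity
    and the form of permutations fixing \<open>i\<close>.\<close>
  have mem: "extend_perm i \<tau> \<in> ?T \<longleftrightarrow> \<tau> \<in> ?S" if \<tau>: "\<tau> \<in> Bij Y" for \<tau>
  proof -
    let ?P = "pullback_edges Y ?L \<tau>"
    have bij: "bij_betw \<tau> Y Y" using \<tau> by (simp add: Bij_def)
    then obtain k where k: "k \<in> Y" "\<tau> k = j" using j by (metis bij_betw_def imageE)
    have kj: "k = j \<longleftrightarrow> \<tau> j = j"
      using k j bij by (metis bij_betw_def inj_onD)
    have P: "?P \<subseteq> Pow Y" by (rule pullback_edges_subset_Pow)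
    have "insert {i, k} ?P = insert {i, j} ?L \<longleftrightarrow> ?P = ?L \<and> k = j"
    proof -
      have "{i, x} \<notin> ?P" "{i, x} \<notin> ?L" for x using P L assms(6) by auto
      then show ?thesis by (metis doubleton_eq_iff insertE insertI1 insert_ident)
    qed
    then have "extend_perm i \<tau> \<in> ?T \<longleftrightarrow>
        ?P = ?L \<and> k = j \<or> exchange Y ?L ?P \<and> k = j \<or> ?P = ?L \<and> k \<noteq> j"
      using exchange_attach_edge[OF L P assms(6) j k(1)] extend_perm_Bij[OF assms(6) \<tau>]
      unfolding fer_perms_fixing_def mem_Collect_eq fer_perms_iff[OF Gd] Xd Ld
        pullback_edges_extend_perm[OF L assms(6) \<tau> k]
      by (simp add: extend_perm_def)
    \<comment> \<open>The first and third alternatives together say that \<open>\<tau>\<close> is an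
      automorphism, whether or not it fixes \<open>j\<close>; the second is an exchange in
      \<open>G\<close> with \<open>\<tau>\<close> fixing \<open>j\<close>.\<close>
    also have "\<dots> \<longleftrightarrow> \<tau> \<in> ?S"
      using \<tau> assms(2) kj by (auto simp: fer_perms_fixing_def fer_perms_iff[OF assms(1)]
          Aut_labels_iff[OF assms(1)])
    finally show ?thesis .
  qed
  have T: "extend_perm i ` ?S = ?T"
  proof
    show "extend_perm i ` ?S \<subseteq> ?T" using mem S by blast
    show "?T \<subseteq> extend_perm i ` ?S"
    proof
      fix \<sigma> assume \<sigma>: "\<sigma> \<in> ?T"
      then have "\<sigma> \<in> Bij (insert i Y)" "\<sigma> i = i"
        using Xd by (auto simp: fer_perms_fixing_def fer_perms_iff[OF Gd])
      then obtain \<tau> where "\<tau> \<in> Bij Y" "\<sigma> = extend_perm i \<tau>"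
        using Bij_fixing_extend_perm assms(6) by metis
      then show "\<sigma> \<in> extend_perm i ` ?S" using mem \<sigma> by auto
    qed
  qed
  have inj: "inj_on (extend_perm i) (Bij Y)" by (rule inj_on_extend_perm[OF assms(6)])
  have one: "bij_betw (extend_perm i) ?S ?T"
    using T inj_on_subset[OF inj S] by (simp add: bij_betw_def)
  interpret group_hom "BijGroup Y" "BijGroup (insert i Y)" "extend_perm i"
    by (rule group_hom_extend_perm[OF assms(6)])
  have carrier: "carrier (BijGroup Y) = Bij Y" by (simp add: BijGroup_def)
  have SB: "?S \<subseteq> carrier (BijGroup Y)" using S carrier by simp
  have TB: "?T \<subseteq> carrier (BijGroup (insert i Y))" 
    unfolding T[symmetric] using SB hom_closed by blast
  have cS: "carrier (hang_group G j) = generate (BijGroup Y) ?S"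
    using SB assms(2) by (simp add: hang_group_def carrier_subgroup_generated Int_absorb1)
  have cT: "carrier (Fer_fixing Gd i) = generate (BijGroup (insert i Y)) ?T"
    using TB Xd by (simp add: Fer_fixing_def carrier_subgroup_generated Int_absorb1)
  have gB: "generate (BijGroup Y) ?S \<subseteq> Bij Y"
    using G.generate_incl[OF SB] carrier by simp
  \<comment> \<open>A homomorphism maps the subgroup generated by \<open>?S\<close> onto the one
    generated by its image \<open>?T\<close>.\<close>
  have "bij_betw (extend_perm i) (carrier (hang_group G j)) (carrier (Fer_fixing Gd i))"
    unfolding bij_betw_def cS cT using generate_img[OF SB] T inj_on_subset[OF inj gB] by simp
  moreover have "extend_perm i \<in> hom (hang_group G j) (Fer_fixing Gd i)"
  proof (rule homI)
    fix x assume "x \<in> carrier (hang_group G j)"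
    then show "extend_perm i x \<in> carrier (Fer_fixing Gd i)"
      using calculation bij_betwE by blast
  next
    fix x y assume "x \<in> carrier (hang_group G j)" "y \<in> carrier (hang_group G j)"
    then have "x \<in> carrier (BijGroup Y)" "y \<in> carrier (BijGroup Y)"
      using cS gB carrier by auto
    then show "extend_perm i (x \<otimes>\<^bsub>hang_group G j\<^esub> y)
        = extend_perm i x \<otimes>\<^bsub>Fer_fixing Gd i\<^esub> extend_perm i y"
      using hom_mult by (simp add: hang_group_def Fer_fixing_def assms(2) Xd)
  qed
  ultimately have two: "extend_perm i \<in> iso (hang_group G j) (Fer_fixing Gd i)"
    by (simp add: iso_def)
  have grp: "group (hang_group G j)"
    using group_BijGroup group.group_subgroup_generated unfolding hang_group_def by blast
  have fin: "finite (verts G)" and "card (labels G) = card (verts G)"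
    using assms(1) bij_betw_same_card
    by (fastforce simp: labeled_graph_def simple_graph_def)+
  \<comment> \<open>The new leaf accounts for the \<open>- 1\<close> in
    \<open>stem_symmetric\<close>, so both symmetry notions refer to the same degree.\<close>
  then have card: "card (verts Gd) - 1 = card (labels G)"
    using assms(5,7) by (simp add: attach_leaf_def)
  have finY: "finite (labels G)"
    using fin assms(1) bij_betw_finite by (auto simp: labeled_graph_def)
  have isoGd: "hang_group G j \<cong> Fer_fixing Gd i" using two is_isoI by blast
  have "stem_symmetric Gd i \<longleftrightarrow> hang_group G j \<cong> sym_group (card (labels G))"
    unfolding stem_symmetric_def card
    using isoGd group.iso_sym[OF grp isoGd] iso_trans by blast
  then have three: "stem_symmetric Gd i \<longleftrightarrow> hang_symmetric G j"
    using hang_group_iso_sym_group_iff[OF finY] by blast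
  show ?thesis using one two three by blast
qed

end
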